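(* Let $K\subseteq[0,1]^n$ be compact. A function $f:K\to[0,1]$ is implementable by a Bernoulli factory (on $K$) if and only if $f$ is continuous and both $f$ and $1-f$ are polynomially bounded on $K$.
   Context: A (multiparameter) Bernoulli factory with input $(p_1,\dots,p_n)$ is a (possibly infinite) rooted binary tree in which every node has either $2$ children or $0$ children (leaf). Each internal node is labelled either by an index $i\in[n]$ or by a constant $c\in(0,1)$; each leaf is labelled $0$ or $1$. To execute it with coins $p\in[0,1]^n$, start at the root; at a node labelled $i$ draw a fresh independent Bernoulli($p_i$) sample, at a node labelled $c$ a fresh independent Bernoulli($c$) sample; move to the child corresponding to the outcome; upon reaching a leaf output its label. $f:K\to[0,1]$ is implementable by a Bernoulli factory if there is such a tree which, for every $p\in K$, reaches a leaf almost surely and outputs $1$ with probability exactly $f(p)$. For a partition $[n]=A\sqcup S\sqcup B$, the open face is $F_{A,S,B}=\{p\in[0,1]^n: p_i=0\ (i\in A),\ 0<p_i<1\ (i\in S),\ p_i=1\ (i\in B)\}$. For $T\subseteq[n]$, $p^T=\prod_{i\in T}p_i$, $(1-p)^T=\prod_{i\in T}(1-p_i)$. A function $h:K\to[0,1]$ is polynomially bounded on $K$ if there exist an integer $m\ge0$ and a real $c>0$ such that for every open face $F_{A,S,B}$: if there is $q\in K\cap F_{A,S,B}$ with $h(q)>0$, then $h(p)\ge c\left((1-p)^A p^S(1-p)^S p^B\right)^m$ for all $p\in K$. *)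

theory Defs
  imports "HOL-Analysis.Analysis"
begin

text \<open>A (possibly infinite) rooted binary tree is given by a labelling of
addresses (bool lists; [] is the root, w @ [b] is the child of w reached on
sample outcome b, True = outcome 1). Only addresses all of whose proper
prefixes are internal nodes are part of the tree.\<close>

datatype 'i bf_node = Leaf bool | Coin 'i | Const real

type_synonym 'i bf_tree = "bool list \<Rightarrow> 'i bf_node"

definition bf_wf :: "'i bf_tree \<Rightarrow> bool" where
  "bf_wf T \<longleftrightarrow> (\<forall>w c. T w = Const c \<longrightarrow> 0 < c \<and> c < 1)"

definition bf_reachable :: "'i bf_tree \<Rightarrow> bool list \<Rightarrow> bool" where
  "bf_reachable T w \<longleftrightarrow> (\<forall>k<length w. \<forall>b. T (take k w) \<noteq> Leaf b)"

fun bf_edge :: "'n bf_node \<Rightarrow> (real^'n) \<Rightarrow> bool \<Rightarrow> real" where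
  "bf_edge (Coin i) p b = (if b then p$i else 1 - p$i)"
| "bf_edge (Const c) p b = (if b then c else 1 - c)"
| "bf_edge (Leaf _) p b = 0"

definition bf_path_prob :: "'n bf_tree \<Rightarrow> real^'n \<Rightarrow> bool list \<Rightarrow> real" where
  "bf_path_prob T p w = (\<Prod>k<length w. bf_edge (T (take k w)) p (w ! k))"

definition bf_leaves :: "'i bf_tree \<Rightarrow> bool \<Rightarrow> bool list set" where
  "bf_leaves T b = {w. bf_reachable T w \<and> T w = Leaf b}"

definition bf_halt_prob :: "'n bf_tree \<Rightarrow> real^'n \<Rightarrow> real" where
  "bf_halt_prob T p = infsum (bf_path_prob T p) (bf_leaves T True \<union> bf_leaves T False)"

definition bf_out_prob :: "'n bf_tree \<Rightarrow> real^'n \<Rightarrow> real" where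
  "bf_out_prob T p = infsum (bf_path_prob T p) (bf_leaves T True)"

definition implementable :: "(real^'n::finite) set \<Rightarrow> (real^'n \<Rightarrow> real) \<Rightarrow> bool" where
  "implementable K f \<longleftrightarrow> (\<exists>T. bf_wf T \<and>
      (\<forall>p\<in>K. bf_halt_prob T p = 1 \<and> bf_out_prob T p = f p))"

definition open_face :: "'n set \<Rightarrow> 'n set \<Rightarrow> 'n set \<Rightarrow> (real^'n) set" where
  "open_face A S B = {p. (\<forall>i\<in>A. p$i = 0) \<and> (\<forall>i\<in>S. 0 < p$i \<and> p$i < 1) \<and> (\<forall>i\<in>B. p$i = 1)}"

definition is_partition3 :: "'n set \<Rightarrow> 'n set \<Rightarrow> 'n set \<Rightarrow> bool" where
  "is_partition3 A S B \<longleftrightarrow> A \<union> S \<union> B = UNIV \<and> A \<inter> S = {} \<and> A \<inter> B = {} \<and> S \<inter> B = {}"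

definition poly_bounded :: "(real^'n::finite) set \<Rightarrow> (real^'n \<Rightarrow> real) \<Rightarrow> bool" where
  "poly_bounded K h \<longleftrightarrow> (\<exists>(m::nat) (c::real). c > 0 \<and>
     (\<forall>A S B. is_partition3 A S B \<longrightarrow> (\<exists>q\<in>K \<inter> open_face A S B. h q > 0) \<longrightarrow>
        (\<forall>p\<in>K. h p \<ge> c * ((\<Prod>i\<in>A. 1 - p$i) * (\<Prod>i\<in>S. p$i) * (\<Prod>i\<in>S. 1 - p$i)
                              * (\<Prod>i\<in>B. p$i)) ^ m)))"

end

theory Submission
  imports Defs
begin

text \<open>Necessity: both output probabilities are increasing limits of polynomials, hence lower
  semicontinuous, and as they add up to 1 on \<open>K\<close> they are continuous; a single leaf that is reached
  with positive probability at one point of a face gives the polynomial lower bound.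

  Sufficiency: the polynomial bounds give implementable \<open>u \<le> f\<close> and \<open>v \<le> 1 - f\<close> with the same zeros
  on \<open>K\<close> as \<open>f\<close> and \<open>1 - f\<close>. Racing them yields the implementable function \<open>r = u / (u + v)\<close>, which
  is 0 or 1 only where \<open>f\<close> is and satisfies \<open>r \<le> C f\<close> and \<open>1 - r \<le> C (1 - f)\<close>. If \<open>h\<close> is implementable
  and uniformly close to \<open>f\<close>, then, for large \<open>N\<close>, taking \<open>N\<close> samples of \<open>r\<close>, and asking \<open>h\<close> unless
  they agree, gives an implementable \<open>g\<close> with \<open>g \<le> 2 f\<close> and \<open>1 - g \<le> 2 (1 - f)\<close>. Then
  \<open>f = g / 4 + 3 f' / 4\<close>, where \<open>f'\<close> is controlled by the same \<open>r\<close>; iterating writes \<open>f\<close> as a countable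
  mixture of implementable functions.\<close>

section \<open>Output probabilities as limits of depth-truncated ones\<close>

definition child :: "'i bf_tree \<Rightarrow> bool \<Rightarrow> 'i bf_tree" where
  "child T c = (\<lambda>w. T (c # w))"

definition out :: "bool \<Rightarrow> 'n bf_tree \<Rightarrow> real^'n \<Rightarrow> real" where
  "out b T p = infsum (bf_path_prob T p) (bf_leaves T b)"

definition cube :: "(real^'n) set" where
  "cube = {p. \<forall>i. 0 \<le> p$i \<and> p$i \<le> 1}"

text \<open>The probability of stopping with \<open>b\<close> at depth less than \<open>n\<close>.
  Recursion on the first sample suits inductions over trees; at a leaf both edge terms vanish by the
  convention in \<open>bf_edge\<close>.\<close>

fun out_within :: "nat \<Rightarrow> bool \<Rightarrow> 'n bf_tree \<Rightarrow> real^'n \<Rightarrow> real" where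
  "out_within 0 b T p = 0"
| "out_within (Suc n) b T p = of_bool (T [] = Leaf b)
     + bf_edge (T []) p True * out_within n b (child T True) p
     + bf_edge (T []) p False * out_within n b (child T False) p"

lemma bf_wf_child: "bf_wf T \<Longrightarrow> bf_wf (child T c)"
  unfolding bf_wf_def child_def by blast

lemma bf_edge_nonneg:
  assumes "bf_wf T" "p \<in> cube" shows "0 \<le> bf_edge (T w) p c"
  using assms unfolding bf_wf_def cube_def
  by (cases "T w") (force simp: less_imp_le)+

lemma bf_path_prob_Nil [simp]: "bf_path_prob T p [] = 1"
  by (simp add: bf_path_prob_def)

lemma bf_path_prob_Cons [simp]:
  "bf_path_prob T p (c # w) = bf_edge (T []) p c * bf_path_prob (child T c) p w"
  by (simp add: bf_path_prob_def child_def prod.lessThan_Suc_shift del: prod.lessThan_Suc)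

lemma bf_path_prob_nonneg: "bf_wf T \<Longrightarrow> p \<in> cube \<Longrightarrow> 0 \<le> bf_path_prob T p w"
  unfolding bf_path_prob_def by (intro prod_nonneg) (auto intro: bf_edge_nonneg)

lemma Nil_in_bf_leaves [simp]: "[] \<in> bf_leaves T b \<longleftrightarrow> T [] = Leaf b"
  by (simp add: bf_leaves_def bf_reachable_def)

lemma Cons_in_bf_leaves [simp]:
  "c # w \<in> bf_leaves T b \<longleftrightarrow> (\<forall>a. T [] \<noteq> Leaf a) \<and> w \<in> bf_leaves (child T c) b"
proof -
  have "(\<forall>k<Suc (length w). \<forall>b. T (take k (c # w)) \<noteq> Leaf b) \<longleftrightarrow>
    (\<forall>a. T [] \<noteq> Leaf a) \<and> (\<forall>k<length w. \<forall>b. T (c # take k w) \<noteq> Leaf b)"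
    by (auto simp: All_less_Suc2)
  then show ?thesis by (auto simp: bf_leaves_def bf_reachable_def child_def)
qed

lemma finite_short_words: "finite {w :: bool list. w \<in> A \<and> length w < n}"
proof -
  have "finite {w :: bool list. set w \<subseteq> UNIV \<and> length w \<le> n}"
    by (rule finite_lists_length_le) simp
  then show ?thesis by (rule rev_finite_subset) auto
qed

text \<open>Splitting words at their first letter matches the recursion; this is the bridge to the
  sum over leaves in \<open>out\<close>.\<close>

lemma out_within_eq_sum:
  "out_within n b T p = (\<Sum>w | w \<in> bf_leaves T b \<and> length w < n. bf_path_prob T p w)"
proof (induction n arbitrary: T)
  case (Suc n)
  let ?L = "\<lambda>T n. {w. w \<in> bf_leaves T b \<and> length w < n}"
  show ?case
  proof (cases "T []")
    case (Leaf c)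
    have L: "?L T (Suc n) = (if c = b then {[]} else {})"
      (is "?A = ?B")
    proof (intro set_eqI)
      fix w show "w \<in> ?A \<longleftrightarrow> w \<in> ?B" using Leaf by (cases w) auto
    qed
    show ?thesis unfolding L using Leaf by simp
  next
    have *: "?case" if nl: "\<forall>a. T [] \<noteq> Leaf a"
    proof -
      have "?L T (Suc n) = Cons True ` ?L (child T True) n \<union> Cons False ` ?L (child T False) n"
        (is "?A = ?B")
      proof (rule set_eqI)
        fix w show "w \<in> ?A \<longleftrightarrow> w \<in> ?B"
        proof (cases w)
          case (Cons a v)
          then show ?thesis using nl by (cases a) auto
        qed (use nl in auto)
      qed
      note L = this
      have "sum (bf_path_prob T p) (?L T (Suc n)) =
        sum (bf_path_prob T p) (Cons True ` ?L (child T True) n) +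
        sum (bf_path_prob T p) (Cons False ` ?L (child T False) n)"
        unfolding L
      proof (rule sum.union_disjoint)
        show "finite (Cons True ` ?L (child T True) n)" "finite (Cons False ` ?L (child T False) n)"
          by (rule finite_imageI, rule finite_short_words)+
      qed blast
      also have "\<dots> = (\<Sum>w\<in>?L (child T True) n. bf_path_prob T p (True # w)) +
        (\<Sum>w\<in>?L (child T False) n. bf_path_prob T p (False # w))"
        by (simp add: sum.reindex)
      finally show ?thesis using nl by (simp add: Suc.IH sum_distrib_left)
    qed
    { case (Coin i) then show ?thesis by (intro *) auto }
    { case (Const c) then show ?thesis by (intro *) auto }
  qed
qed simp

lemma out_within_nonneg: "bf_wf T \<Longrightarrow> p \<in> cube \<Longrightarrow> 0 \<le> out_within n b T p"
  by (simp add: out_within_eq_sum sum_nonneg bf_path_prob_nonneg)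

lemma out_within_sum_le_1:
  "bf_wf T \<Longrightarrow> p \<in> cube \<Longrightarrow> out_within n True T p + out_within n False T p \<le> 1"
proof (induction n arbitrary: T)
  case (Suc n)
  let ?e = "\<lambda>c. bf_edge (T []) p c"
  let ?s = "\<lambda>c. out_within n True (child T c) p + out_within n False (child T c) p"
  have "?e c * ?s c \<le> ?e c * 1" for c
    using Suc by (intro mult_left_mono) (auto simp: bf_wf_child bf_edge_nonneg)
  from add_mono[OF this[of True] this[of False]]
  have "?e True * ?s True + ?e False * ?s False \<le> ?e True + ?e False" by simp
  \<comment> \<open>Either the root is a leaf, with one indicator equal to 1 and both edges 0, or
    both indicators vanish and the edges add up to 1.\<close>
  moreover have "of_bool (T [] = Leaf True) + of_bool (T [] = Leaf False) + (?e True + ?e False) \<le> (1::real)"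
    by (cases "T []") auto
  ultimately show ?case by (simp add: algebra_simps)
qed simp

context
  fixes T :: "'n::finite bf_tree" and p :: "real^'n"
  assumes wf: "bf_wf T" and p: "p \<in> cube"
begin

text \<open>A finite set of leaves has bounded depth, so its total is at most some
  \<open>out_within n b T p\<close>, hence at most 1.\<close>

lemma bf_path_prob_summable: "bf_path_prob T p summable_on bf_leaves T b"
proof (rule nonneg_bounded_partial_sums_imp_summable_on)
  show "\<forall>\<^sub>F F in finite_subsets_at_top (bf_leaves T b). sum (bf_path_prob T p) F \<le> 1"
  proof (rule eventually_finite_subsets_at_top_weakI)
    fix F assume F: "finite F" "F \<subseteq> bf_leaves T b"
    define n where "n = Suc (Max (length ` F))"
    have "length w < n" if "w \<in> F" for w
      using F that by (auto simp: n_def less_Suc_eq_le)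
    then have "sum (bf_path_prob T p) F \<le> out_within n b T p"
      unfolding out_within_eq_sum using F
      by (intro sum_mono2 finite_short_words) (auto simp: bf_path_prob_nonneg wf p)
    also have "\<dots> \<le> 1"
      using out_within_sum_le_1[OF wf p, of n] out_within_nonneg[OF wf p, of n True]
        out_within_nonneg[OF wf p, of n False] by (cases b) auto
    finally show "sum (bf_path_prob T p) F \<le> 1" .
  qed
qed (auto simp: bf_path_prob_nonneg wf p)

lemma out_within_le_out: "out_within n b T p \<le> out b T p"
  unfolding out_within_eq_sum out_def
  by (intro finite_sum_le_infsum bf_path_prob_summable finite_short_words)
     (auto simp: bf_path_prob_nonneg wf p)

text \<open>The leaves at depth below \<open>n\<close> form finite sets that eventually contain any
  given finite set of leaves, so the truncations follow the filter that defines the infinite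
  sum.\<close>

lemma out_within_tendsto_out: "(\<lambda>n. out_within n b T p) \<longlonglongrightarrow> out b T p"
proof -
  have "filterlim (\<lambda>n. {w. w \<in> bf_leaves T b \<and> length w < n}) (finite_subsets_at_top (bf_leaves T b)) sequentially"
    unfolding filterlim_finite_subsets_at_top
  proof (intro allI impI)
    fix X assume X: "finite X \<and> X \<subseteq> bf_leaves T b"
    have "length w < n" if "w \<in> X" "Suc (Max (length ` X)) \<le> n" for w n
      using X that by (meson Max_ge finite_imageI imageI le_imp_less_Suc less_le_trans)
    then show "\<forall>\<^sub>F n in sequentially. finite {w. w \<in> bf_leaves T b \<and> length w < n} \<and>
        X \<subseteq> {w. w \<in> bf_leaves T b \<and> length w < n} \<and> {w. w \<in> bf_leaves T b \<and> length w < n} \<subseteq> bf_leaves T b"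
      using X by (intro eventually_sequentiallyI[of "Suc (Max (length ` X))"]) (auto simp: finite_short_words)
  qed
  moreover have "(sum (bf_path_prob T p) \<longlongrightarrow> out b T p) (finite_subsets_at_top (bf_leaves T b))"
    using has_sum_infsum[OF bf_path_prob_summable] unfolding has_sum_def out_def .
  ultimately show ?thesis
    unfolding out_within_eq_sum by (rule filterlim_compose[rotated])
qed

lemma out_nonneg: "0 \<le> out b T p"
  using out_within_le_out[of 0] by simp

lemma out_sum_le_1: "out True T p + out False T p \<le> 1"
  by (rule LIMSEQ_le_const2[OF tendsto_add[OF out_within_tendsto_out out_within_tendsto_out]])
     (use out_within_sum_le_1 wf p in blast)

lemma bf_halt_prob_eq: "bf_halt_prob T p = out True T p + out False T p"
proof -
  have "bf_leaves T True \<inter> bf_leaves T False = {}" by (auto simp: bf_leaves_def)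
  then show ?thesis
    unfolding bf_halt_prob_def out_def by (intro infsum_Un_disjoint bf_path_prob_summable)
qed

end

text \<open>First-step analysis, obtained by letting the depth tend to infinity in
  \<open>out_within\<close>. The outputs of composed trees are estimated through it.\<close>

lemma out_step:
  assumes wf: "bf_wf T" and p: "p \<in> cube"
  shows "out b T p = of_bool (T [] = Leaf b) + bf_edge (T []) p True * out b (child T True) p
     + bf_edge (T []) p False * out b (child T False) p"
proof (rule LIMSEQ_unique)
  show "(\<lambda>n. out_within (Suc n) b T p) \<longlonglongrightarrow> out b T p"
    using out_within_tendsto_out[OF wf p] by (rule LIMSEQ_Suc)
  show "(\<lambda>n. out_within (Suc n) b T p) \<longlonglongrightarrow>
     of_bool (T [] = Leaf b) + bf_edge (T []) p True * out b (child T True) p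
     + bf_edge (T []) p False * out b (child T False) p"
    unfolding out_within.simps by (intro tendsto_intros out_within_tendsto_out bf_wf_child wf p)
qed

text \<open>The halting probability is the sum of the two outputs, so almost sure halting means that
  they add up to 1. This form treats \<open>f\<close> and \<open>1 - f\<close> alike.\<close>

lemma implementable_iff:
  fixes K :: "(real^'n) set"
  assumes K: "K \<subseteq> cube"
  shows "implementable K f \<longleftrightarrow>
    (\<exists>T. bf_wf T \<and> (\<forall>p\<in>K. out True T p = f p \<and> out False T p = 1 - f p))"
proof -
  have "bf_halt_prob T p = 1 \<and> bf_out_prob T p = f p \<longleftrightarrow> out True T p = f p \<and> out False T p = 1 - f p"
    if "bf_wf T" "p \<in> K" for T p
    using bf_halt_prob_eq[of T p] that K by (auto simp: bf_out_prob_def out_def)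
  then show ?thesis unfolding implementable_def by blast
qed

text \<open>Since the two output probabilities never add up to more than 1, lower bounds on both suffice;
  this is what makes limits of composed trees easy to control.\<close>

lemma implementableI:
  fixes K :: "(real^'n) set"
  assumes "K \<subseteq> cube" "bf_wf T"
    and "\<And>p. p \<in> K \<Longrightarrow> f p \<le> out True T p"
    and "\<And>p. p \<in> K \<Longrightarrow> 1 - f p \<le> out False T p"
  shows "implementable K f"
  unfolding implementable_iff[OF assms(1)]
proof (intro exI conjI ballI)
  fix p assume p: "p \<in> K"
  have "out True T p + out False T p \<le> 1" using p assms(1,2) by (intro out_sum_le_1) auto
  with assms(3)[OF p] assms(4)[OF p] show "out True T p = f p" "out False T p = 1 - f p" by linarith+
qed (fact assms)

lemma implementableE:
  fixes K :: "(real^'n) set"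
  assumes "implementable K f" "K \<subseteq> cube"
  obtains T where "bf_wf T" "\<And>p. p \<in> K \<Longrightarrow> out True T p = f p" "\<And>p. p \<in> K \<Longrightarrow> out False T p = 1 - f p"
  using assms implementable_iff by metis

lemma implementable_cong:
  assumes "implementable K f" "\<And>p. p \<in> K \<Longrightarrow> f p = g p"
  shows "implementable K g"
  using assms unfolding implementable_def by auto

lemma implementable_bounds:
  fixes K :: "(real^'n) set"
  assumes "implementable K f" "K \<subseteq> cube" "p \<in> K"
  shows "0 \<le> f p" "f p \<le> 1"
proof -
  obtain T where "bf_wf T" "out True T p = f p" "out False T p = 1 - f p"
    using implementableE[OF assms(1,2)] assms(3) by metis
  then show "0 \<le> f p" "f p \<le> 1"
    using out_nonneg[of T p True] out_nonneg[of T p False] assms by auto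
qed

subsection \<open>Composition of trees\<close>

lemma out_Leaf: "p \<in> cube \<Longrightarrow> out b (\<lambda>_. Leaf c) p = of_bool (c = b)"
  by (subst out_step) (auto simp: bf_wf_def)

lemma bf_wf_Leaf [simp]: "bf_wf (\<lambda>_. Leaf c)"
  by (simp add: bf_wf_def)

fun branch :: "'i bf_node \<Rightarrow> 'i bf_tree \<Rightarrow> 'i bf_tree \<Rightarrow> 'i bf_tree" where
  "branch x T1 T0 [] = x"
| "branch x T1 T0 (c # w) = (if c then T1 else T0) w"

lemma child_branch [simp]: "child (branch x T1 T0) c = (if c then T1 else T0)"
  by (auto simp: child_def)

lemma bf_wf_branch:
  "(\<And>c. x = Const c \<Longrightarrow> 0 < c \<and> c < 1) \<Longrightarrow> bf_wf T1 \<Longrightarrow> bf_wf T0 \<Longrightarrow> bf_wf (branch x T1 T0)"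
  unfolding bf_wf_def
proof (intro allI impI)
  fix w c
  assume "\<And>c. x = Const c \<Longrightarrow> 0 < c \<and> c < 1" "\<forall>w c. T1 w = Const c \<longrightarrow> 0 < c \<and> c < 1"
    "\<forall>w c. T0 w = Const c \<longrightarrow> 0 < c \<and> c < 1" "branch x T1 T0 w = Const c"
  then show "0 < c \<and> c < 1" by (cases w) (auto split: if_splits)
qed

text \<open>The address follows \<open>T\<close> until a leaf, and what is left of it is read in the
  continuation selected there. The continuations are thus queried only at addresses no longer than
  the given one, so a continuation may itself be defined by recursion on addresses.\<close>

primrec cond :: "bool list \<Rightarrow> 'i bf_tree \<Rightarrow> 'i bf_tree \<Rightarrow> 'i bf_tree \<Rightarrow> 'i bf_node" where
  "cond [] T X1 X0 = (case T [] of Leaf b \<Rightarrow> (if b then X1 else X0) [] | x \<Rightarrow> x)"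
| "cond (c # w) T X1 X0 = (case T [] of Leaf b \<Rightarrow> (if b then X1 else X0) (c # w)
     | x \<Rightarrow> cond w (child T c) X1 X0)"

definition ite :: "'i bf_tree \<Rightarrow> 'i bf_tree \<Rightarrow> 'i bf_tree \<Rightarrow> 'i bf_tree" where
  "ite T X1 X0 = (\<lambda>w. cond w T X1 X0)"

lemma ite_Leaf: "T [] = Leaf b \<Longrightarrow> ite T X1 X0 = (if b then X1 else X0)"
  unfolding ite_def
proof (rule ext)
  fix w assume "T [] = Leaf b"
  then show "cond w T X1 X0 = (if b then X1 else X0) w" by (cases w) auto
qed

lemma ite_Nil: "\<forall>b. T [] \<noteq> Leaf b \<Longrightarrow> ite T X1 X0 [] = T []"
  by (simp add: ite_def split: bf_node.splits)

lemma child_ite: "\<forall>b. T [] \<noteq> Leaf b \<Longrightarrow> child (ite T X1 X0) c = ite (child T c) X1 X0"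
  by (cases "T []") (simp_all add: ite_def child_def, blast)

text \<open>The restriction on lengths makes the rule usable when a continuation is the very tree
  being checked, in an induction on the length of the address.\<close>

lemma cond_ConstD:
  assumes "cond w T X1 X0 = Const c" "bf_wf T"
    and "\<And>b v c. length v \<le> length w \<Longrightarrow> (if b then X1 else X0) v = Const c \<Longrightarrow> 0 < c \<and> c < 1"
  shows "0 < c \<and> c < 1"
  using assms
proof (induction w arbitrary: T)
  case Nil
  show ?case
  proof (cases "T []")
    case (Leaf b)
    then show ?thesis using Nil.prems(1) Nil.prems(3)[of "[]" b] by simp
  qed (use Nil.prems(1,2) in \<open>auto simp: bf_wf_def\<close>)
next
  case (Cons a w)
  have IH: "cond w (child T a) X1 X0 = Const c \<Longrightarrow> 0 < c \<and> c < 1"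
    using Cons.IH[OF _ bf_wf_child[OF Cons.prems(2)]] Cons.prems(3) by (metis le_SucI length_Cons)
  show ?case
  proof (cases "T []")
    case (Leaf b)
    then show ?thesis using Cons.prems(1) Cons.prems(3)[of "a # w" b] by simp
  qed (use Cons.prems(1) IH in auto)
qed

lemma bf_wf_ite:
  assumes "bf_wf T" "bf_wf X1" "bf_wf X0"
  shows "bf_wf (ite T X1 X0)"
proof -
  have "cond w T X1 X0 = Const c \<Longrightarrow> 0 < c \<and> c < 1" for w c
    by (erule cond_ConstD) (use assms in \<open>auto simp: bf_wf_def split: if_splits\<close>)
  then show ?thesis unfolding ite_def by (simp add: bf_wf_def)
qed

text \<open>Only the run of \<open>T\<close> is truncated while the continuations keep their full
  output, so the induction on the depth rests on \<open>out_step\<close> for the composed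
  tree.\<close>

lemma out_within_ite:
  assumes X: "bf_wf X1" "bf_wf X0" and p: "p \<in> cube" and "bf_wf T"
  shows "out_within n True T p * out b X1 p + out_within n False T p * out b X0 p \<le> out b (ite T X1 X0) p"
  using \<open>bf_wf T\<close>
proof (induction n arbitrary: T)
  case 0
  then show ?case by (simp add: out_nonneg bf_wf_ite X p)
next
  case (Suc n)
  show ?case
  proof (cases "\<exists>a. T [] = Leaf a")
    case True
    then show ?thesis by (auto simp: ite_Leaf)
  next
    case False
    let ?e = "\<lambda>c. bf_edge (T []) p c"
    let ?s = "\<lambda>c. out_within n True (child T c) p * out b X1 p + out_within n False (child T c) p * out b X0 p"
    have "?e c * ?s c \<le> ?e c * out b (ite (child T c) X1 X0) p" for c
      using Suc p by (intro mult_left_mono) (auto simp: bf_wf_child bf_edge_nonneg)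
    from add_mono[OF this[of True] this[of False]] False show ?thesis
      by (subst out_step[OF bf_wf_ite[OF Suc.prems X] p])
        (simp add: ite_Nil child_ite algebra_simps)
  qed
qed

lemma out_ite:
  assumes X: "bf_wf X1" "bf_wf X0" and p: "p \<in> cube" and T: "bf_wf T"
  shows "out True T p * out b X1 p + out False T p * out b X0 p \<le> out b (ite T X1 X0) p"
proof (rule LIMSEQ_le_const2)
  show "(\<lambda>n. out_within n True T p * out b X1 p + out_within n False T p * out b X0 p)
    \<longlonglongrightarrow> out True T p * out b X1 p + out False T p * out b X0 p"
    by (intro tendsto_intros out_within_tendsto_out T p)
qed (use out_within_ite assms in blast)

section \<open>Closure properties of implementable functions\<close>

lemma implementable_const:
  fixes K :: "(real^'n) set"
  assumes K: "K \<subseteq> cube" and "0 \<le> c" "c \<le> 1"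
  shows "implementable K (\<lambda>_. c)"
proof -
  consider "c = 0" | "c = 1" | "0 < c" "c < 1" using assms by linarith
  then show ?thesis
  proof cases
    case 1
    with K show ?thesis by (intro implementableI[where T = "\<lambda>_. Leaf False"]) (auto simp: out_Leaf subset_iff)
  next
    case 2
    with K show ?thesis by (intro implementableI[where T = "\<lambda>_. Leaf True"]) (auto simp: out_Leaf subset_iff)
  next
    case 3
    define T :: "'n bf_tree" where "T = branch (Const c) (\<lambda>_. Leaf True) (\<lambda>_. Leaf False)"
    have "bf_wf T" unfolding T_def using 3 by (intro bf_wf_branch) auto
    then have "out b T p = (if b then c else 1 - c)" if "p \<in> K" for b p
      using that K by (subst out_step) (auto simp: T_def out_Leaf subset_iff)
    with \<open>bf_wf T\<close> K show ?thesis by (intro implementableI[where T = T]) auto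
  qed
qed

lemma implementable_coord:
  fixes K :: "(real^'n) set"
  assumes K: "K \<subseteq> cube"
  shows "implementable K (\<lambda>p. p $ i)"
proof -
  define T :: "'n bf_tree" where "T = branch (Coin i) (\<lambda>_. Leaf True) (\<lambda>_. Leaf False)"
  have "bf_wf T" unfolding T_def by (intro bf_wf_branch) auto
  then have "out b T p = (if b then p $ i else 1 - p $ i)" if "p \<in> K" for b p
    using that K by (subst out_step) (auto simp: T_def out_Leaf subset_iff)
  with \<open>bf_wf T\<close> K show ?thesis by (intro implementableI[where T = T]) auto
qed

lemma implementable_ite:
  fixes K :: "(real^'n) set"
  assumes K: "K \<subseteq> cube" and h: "implementable K h" and g: "implementable K g1" "implementable K g0"
  shows "implementable K (\<lambda>p. h p * g1 p + (1 - h p) * g0 p)"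
proof -
  from implementableE[OF h K] obtain T
    where T: "bf_wf T" "\<And>p. p \<in> K \<Longrightarrow> out True T p = h p" "\<And>p. p \<in> K \<Longrightarrow> out False T p = 1 - h p"
    by blast
  from implementableE[OF g(1) K] obtain X1
    where X1: "bf_wf X1" "\<And>p. p \<in> K \<Longrightarrow> out True X1 p = g1 p" "\<And>p. p \<in> K \<Longrightarrow> out False X1 p = 1 - g1 p"
    by blast
  from implementableE[OF g(2) K] obtain X0
    where X0: "bf_wf X0" "\<And>p. p \<in> K \<Longrightarrow> out True X0 p = g0 p" "\<And>p. p \<in> K \<Longrightarrow> out False X0 p = 1 - g0 p"
    by blast
  show ?thesis
  proof (rule implementableI[OF K])
    show "bf_wf (ite T X1 X0)" by (intro bf_wf_ite T X1 X0)
    fix p assume p: "p \<in> K"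
    then have "p \<in> cube" using K by auto
    from out_ite[OF X1(1) X0(1) this T(1)]
    have *: "out True T p * out b X1 p + out False T p * out b X0 p \<le> out b (ite T X1 X0) p" for b .
    show "h p * g1 p + (1 - h p) * g0 p \<le> out True (ite T X1 X0) p"
      using *[of True] T X1 X0 p by simp
    \<comment> \<open>The complement of a mixture is the mixture of the complements with the same
      weights, so the bound from \<open>out_ite\<close> serves both outputs.\<close>
    have "1 - (h p * g1 p + (1 - h p) * g0 p) = h p * (1 - g1 p) + (1 - h p) * (1 - g0 p)"
      by (simp add: algebra_simps)
    then show "1 - (h p * g1 p + (1 - h p) * g0 p) \<le> out False (ite T X1 X0) p"
      using *[of False] T X1 X0 p by simp
  qed
qed

lemma implementable_compl:
  fixes K :: "(real^'n) set"
  assumes K: "K \<subseteq> cube" and f: "implementable K f"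
  shows "implementable K (\<lambda>p. 1 - f p)"
  using implementable_ite[OF K f implementable_const[OF K, of 0] implementable_const[OF K, of 1]] by simp

lemma implementable_mult:
  fixes K :: "(real^'n) set"
  assumes K: "K \<subseteq> cube" and f: "implementable K f" "implementable K g"
  shows "implementable K (\<lambda>p. f p * g p)"
  using implementable_ite[OF K f implementable_const[OF K, of 0]] by simp

lemma implementable_power:
  fixes K :: "(real^'n) set"
  assumes K: "K \<subseteq> cube" and f: "implementable K f"
  shows "implementable K (\<lambda>p. f p ^ m)"
  by (induction m) (simp_all add: implementable_const implementable_mult K f)

lemma implementable_prod:
  fixes K :: "(real^'n) set"
  assumes K: "K \<subseteq> cube" and f: "finite I" "\<And>i. i \<in> I \<Longrightarrow> implementable K (f i)"
  shows "implementable K (\<lambda>p. \<Prod>i\<in>I. f i p)"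
  using f by (induction I rule: finite_induct) (simp_all add: implementable_const implementable_mult K)

text \<open>As a congruence rule for function definitions it records that continuations are
  evaluated only at addresses no longer than \<open>w'\<close>; the termination proof of
  \<open>race\<close> relies on this.\<close>

lemma cond_cong [fundef_cong]:
  assumes "w = w'" "T = T'"
    and "\<And>v. length v \<le> length w' \<Longrightarrow> X1 v = X1' v" "\<And>v. length v \<le> length w' \<Longrightarrow> X0 v = X0' v"
  shows "cond w T X1 X0 = cond w' T' X1' X0'"
proof -
  have "(\<And>v. length v \<le> length w \<Longrightarrow> X1 v = X1' v) \<Longrightarrow> (\<And>v. length v \<le> length w \<Longrightarrow> X0 v = X0' v) \<Longrightarrow>
    cond w T X1 X0 = cond w T X1' X0'" for T
    by (induction w arbitrary: T) (auto split: bf_node.splits)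
  with assms show ?thesis by auto
qed

text \<open>Toss a fair coin to choose one of the two trees and run it; stop if it outputs 1, reporting
  which tree was run, and start afresh otherwise.\<close>

function race :: "'i bf_tree \<Rightarrow> 'i bf_tree \<Rightarrow> 'i bf_tree" where
  "race U V [] = Const (1/2)"
| "race U V (c # w) = cond w (if c then U else V) (\<lambda>_. Leaf c) (\<lambda>v. race U V v)"
  by pat_completeness auto
termination by (relation "Wellfounded.measure (\<lambda>(U, V, w). length w)") auto

lemma child_race: "child (race U V) c = ite (if c then U else V) (\<lambda>_. Leaf c) (race U V)"
  by (auto simp: child_def ite_def)

lemma bf_wf_race:
  assumes "bf_wf U" "bf_wf V"
  shows "bf_wf (race U V)"
proof -
  have "race U V w = Const c \<Longrightarrow> 0 < c \<and> c < 1" for w c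
  proof (induction w arbitrary: c rule: length_induct)
    case (1 w)
    show ?case
    proof (cases w)
      case Nil with 1 show ?thesis by simp
    next
      case (Cons d w')
      have "cond w' (if d then U else V) (\<lambda>_. Leaf d) (race U V) = Const c" using 1 Cons by simp
      then show ?thesis
        by (rule cond_ConstD) (use 1 Cons assms in \<open>auto simp: less_Suc_eq_le split: if_splits\<close>)
    qed
  qed
  then show ?thesis unfolding bf_wf_def by blast
qed

text \<open>A round that succeeds ends the race and any other restarts it, so the output
  \<open>x\<close> satisfies
  \<open>2 * x >= u * [b] + (1 - u) * x + v * [not b] + (1 - v) * x\<close>. Positivity of
  \<open>u + v\<close> allows solving for \<open>x\<close>, and the lower bounds for the two values
  of \<open>b\<close> add up to 1.\<close>

lemma implementable_race:
  fixes K :: "(real^'n) set"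
  assumes K: "K \<subseteq> cube" and u: "implementable K u" and v: "implementable K v"
    and pos: "\<And>p. p \<in> K \<Longrightarrow> 0 < u p + v p"
  shows "implementable K (\<lambda>p. u p / (u p + v p))"
proof -
  from implementableE[OF u K] obtain U
    where U: "bf_wf U" "\<And>p. p \<in> K \<Longrightarrow> out True U p = u p" "\<And>p. p \<in> K \<Longrightarrow> out False U p = 1 - u p"
    by blast
  from implementableE[OF v K] obtain V
    where V: "bf_wf V" "\<And>p. p \<in> K \<Longrightarrow> out True V p = v p" "\<And>p. p \<in> K \<Longrightarrow> out False V p = 1 - v p"
    by blast
  note wf = bf_wf_race[OF U(1) V(1)]
  have le: "(if b then u p else v p) / (u p + v p) \<le> out b (race U V) p" if p: "p \<in> K" for p b
  proof -
    have c: "p \<in> cube" using p K by auto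
    define x where "x = out b (race U V) p"
    have "2 * x = out b (child (race U V) True) p + out b (child (race U V) False) p"
      unfolding x_def by (subst out_step[OF wf c]) simp
    moreover have "u p * of_bool b + (1 - u p) * x \<le> out b (child (race U V) True) p"
      using out_ite[OF bf_wf_Leaf[of True] wf c U(1), of b] U p c
      by (simp add: child_race out_Leaf x_def)
    moreover have "v p * of_bool (\<not> b) + (1 - v p) * x \<le> out b (child (race U V) False) p"
      using out_ite[OF bf_wf_Leaf[of False] wf c V(1), of b] V p c
      by (simp add: child_race out_Leaf x_def)
    ultimately have "u p * of_bool b + v p * of_bool (\<not> b) \<le> (u p + v p) * x"
      unfolding ring_distribs by linarith
    then show ?thesis using pos[OF p] by (cases b) (simp_all add: x_def pos_divide_le_eq mult.commute)
  qed
  show ?thesis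
  proof (rule implementableI[OF K wf])
    fix p assume p: "p \<in> K"
    show "u p / (u p + v p) \<le> out True (race U V) p" using le[OF p, of True] by simp
    have "1 - u p / (u p + v p) = v p / (u p + v p)" using pos[OF p] by (simp add: field_simps)
    then show "1 - u p / (u p + v p) \<le> out False (race U V) p" using le[OF p, of False] by simp
  qed
qed

text \<open>The index advances with each failed toss: started at 0, the tree \<open>G j\<close> is
  run with probability \<open>1/4 * (3/4)^j\<close>.\<close>

fun mixture :: "(nat \<Rightarrow> 'i bf_tree) \<Rightarrow> nat \<Rightarrow> 'i bf_tree" where
  "mixture G k [] = Const (1/4)"
| "mixture G k (c # w) = (if c then G k w else mixture G (Suc k) w)"

lemma child_mixture: "child (mixture G k) c = (if c then G k else mixture G (Suc k))"
  by (auto simp: child_def)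

lemma bf_wf_mixture:
  assumes "\<And>k. bf_wf (G k)"
  shows "bf_wf (mixture G k)"
proof -
  have "mixture G k w = Const c \<Longrightarrow> 0 < c \<and> c < 1" for w c
    using assms by (induction G k w rule: mixture.induct) (auto simp: bf_wf_def split: if_splits)
  then show ?thesis unfolding bf_wf_def by blast
qed

lemma out_mixture:
  assumes wf: "\<And>k. bf_wf (G k)" and p: "p \<in> cube"
  shows "(\<Sum>k<n. 1/4 * (3/4)^k * out b (G (j + k)) p) \<le> out b (mixture G j) p"
proof (induction n arbitrary: j)
  case 0
  then show ?case by (simp add: out_nonneg bf_wf_mixture wf p)
next
  case (Suc n)
  have "(\<Sum>k<Suc n. 1/4 * (3/4)^k * out b (G (j + k)) p) =
    1/4 * out b (G j) p + 3/4 * (\<Sum>k<n. 1/4 * (3/4)^k * out b (G (Suc j + k)) p)"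
    unfolding sum_distrib_left by (subst sum.lessThan_Suc_shift) (simp add: mult_ac)
  also have "\<dots> \<le> 1/4 * out b (G j) p + 3/4 * out b (mixture G (Suc j)) p"
    using Suc.IH[of "Suc j"] by simp
  also have "\<dots> = out b (mixture G j) p"
    using out_step[OF bf_wf_mixture[OF wf, where k = j] p, of b] by (simp add: child_mixture)
  finally show ?case .
qed

text \<open>The residuals \<open>f k\<close> telescope: \<open>f 0 = (\<Sum>k<n. 1/4 (3/4)^k g k) + (3/4)^n f n\<close>.\<close>

lemma implementable_mixture:
  fixes K :: "(real^'n) set"
  assumes K: "K \<subseteq> cube" and g: "\<And>k. implementable K (g k)"
    and bounds: "\<And>k p. p \<in> K \<Longrightarrow> 0 \<le> f k p \<and> f k p \<le> 1"
    and step: "\<And>k p. p \<in> K \<Longrightarrow> f k p = 1/4 * g k p + 3/4 * f (Suc k) p"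
  shows "implementable K (f 0)"
proof -
  have "\<exists>T. bf_wf T \<and> (\<forall>p\<in>K. out True T p = g k p \<and> out False T p = 1 - g k p)" for k
    using g[of k] unfolding implementable_iff[OF K] .
  then obtain G where G: "\<And>k. bf_wf (G k)"
    "\<And>k p. p \<in> K \<Longrightarrow> out True (G k) p = g k p" "\<And>k p. p \<in> K \<Longrightarrow> out False (G k) p = 1 - g k p"
    by metis
  have tele: "f 0 p = (\<Sum>k<n. 1/4 * (3/4)^k * g k p) + (3/4)^n * f n p" if "p \<in> K" for n p
  proof (induction n)
    case (Suc n)
    then show ?case using step[OF that, of n] by (simp add: algebra_simps)
  qed simp
  have geo: "(\<Sum>k<n. 1/4 * (3/4)^k) = 1 - (3/4 :: real)^n" for n
    by (induction n) (auto simp: algebra_simps)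
  have lim: "(\<lambda>n. c - (3/4)^n) \<longlonglongrightarrow> c" for c :: real
    by (rule tendsto_eq_intros LIMSEQ_realpow_zero | simp)+
  show ?thesis
  proof (rule implementableI[OF K bf_wf_mixture[OF G(1)]])
    fix p assume p: "p \<in> K"
    then have c: "p \<in> cube" using K by auto
    \<comment> \<open>The residual term lies between 0 and \<open>(3/4)^n\<close>, so each partial
      sum falls short of its target by at most \<open>(3/4)^n\<close>, which vanishes in the
      limit.\<close>
    have le: "(3/4)^n * f n p \<le> (3/4)^n" "0 \<le> (3/4)^n * f n p" for n
      using bounds[OF p, of n] by (auto intro: mult_left_le)
    show "f 0 p \<le> out True (mixture G 0) p"
    proof (rule LIMSEQ_le_const2[OF lim], intro exI allI impI)
      fix n
      have "f 0 p - (3/4)^n \<le> (\<Sum>k<n. 1/4 * (3/4)^k * out True (G (0 + k)) p)"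
        using tele[OF p, of n] le[of n] by (simp add: G p)
      then show "f 0 p - (3/4)^n \<le> out True (mixture G 0) p"
        using out_mixture[OF G(1) c] by (rule order_trans)
    qed
    show "1 - f 0 p \<le> out False (mixture G 0) p"
    proof (rule LIMSEQ_le_const2[OF lim], intro exI allI impI)
      fix n
      have "(\<Sum>k<n. 1/4 * (3/4)^k * out False (G (0 + k)) p) =
        (\<Sum>k<n. 1/4 * (3/4)^k) - (\<Sum>k<n. 1/4 * (3/4)^k * g k p)"
        unfolding sum_subtractf[symmetric] by (simp add: G p algebra_simps diff_divide_distrib)
      then have "1 - f 0 p - (3/4)^n \<le> (\<Sum>k<n. 1/4 * (3/4)^k * out False (G (0 + k)) p)"
        using tele[OF p, of n] le[of n] geo[of n] by linarith
      then show "1 - f 0 p - (3/4)^n \<le> out False (mixture G 0) p"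
        using out_mixture[OF G(1) c] by (rule order_trans)
    qed
  qed
qed

subsection \<open>Semicontinuity and lower bounds on faces\<close>

lemma continuous_on_out_within: "continuous_on S (\<lambda>p. out_within n b T p)"
proof (induction n arbitrary: T)
  case (Suc n)
  have "continuous_on S (\<lambda>p. bf_edge x p c)" for x c
    by (cases x; cases c) (auto intro!: continuous_intros)
  moreover have "out_within (Suc n) b T = (\<lambda>p. of_bool (T [] = Leaf b)
     + bf_edge (T []) p True * out_within n b (child T True) p
     + bf_edge (T []) p False * out_within n b (child T False) p)"
    by (rule ext) simp
  ultimately show ?case using Suc by (auto intro!: continuous_on_add continuous_on_mult)
qed simp

text \<open>A strict lower bound at \<open>p\<close> already holds for some truncation, which is
  continuous and lies below \<open>out\<close> on all of \<open>K\<close>, so the bound persists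
  nearby.\<close>

lemma out_lower_semicontinuous:
  assumes "bf_wf T" "K \<subseteq> cube" "p \<in> K" "a < out b T p"
  shows "\<forall>\<^sub>F q in at p within K. a < out b T q"
proof -
  have "p \<in> cube" using assms by auto
  then have "\<forall>\<^sub>F n in sequentially. a < out_within n b T p"
    using order_tendstoD(1)[OF out_within_tendsto_out] assms by blast
  then obtain n where n: "a < out_within n b T p"
    by (auto simp: eventually_sequentially)
  have "(out_within n b T \<longlongrightarrow> out_within n b T p) (at p within K)"
    using continuous_on_out_within[of K n b T] assms(3) by (simp add: continuous_on_def)
  from order_tendstoD(1)[OF this n] have "\<forall>\<^sub>F q in at p within K. a < out_within n b T q" .
  moreover have "\<forall>\<^sub>F q in at p within K. q \<in> K"
    by (simp add: eventually_at_filter)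
  ultimately show ?thesis
  proof eventually_elim
    case (elim q)
    then have "q \<in> cube" using assms by auto
    with elim out_within_le_out[OF assms(1) this, of n b] show ?case by simp
  qed
qed

lemma implementable_imp_continuous_on:
  assumes K: "K \<subseteq> cube" and f: "implementable K f"
  shows "continuous_on K f"
  unfolding continuous_on_def
proof (rule ballI, rule order_tendstoI)
  obtain T where T: "bf_wf T" "\<And>p. p \<in> K \<Longrightarrow> out True T p = f p" "\<And>p. p \<in> K \<Longrightarrow> out False T p = 1 - f p"
    using implementableE[OF f K] by blast
  fix p assume p: "p \<in> K"
  have inK: "\<forall>\<^sub>F q in at p within K. q \<in> K"
    by (simp add: eventually_at_filter)
  show "\<forall>\<^sub>F q in at p within K. a < f q" if "a < f p" for a
    using out_lower_semicontinuous[OF T(1) K p, of a True] that inK T(2) p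
    by (auto elim: eventually_elim2)
  \<comment> \<open>An upper bound on \<open>f\<close> is a lower bound on the output
    \<open>False\<close>, whose value is \<open>1 - f\<close>.\<close>
  show "\<forall>\<^sub>F q in at p within K. f q < a" if "f p < a" for a
  proof -
    have "\<forall>\<^sub>F q in at p within K. 1 - a < out False T q"
      using that by (intro out_lower_semicontinuous[OF T(1) K p]) (simp add: T(3) p)
    with inK show ?thesis by eventually_elim (simp add: T(3))
  qed
qed

text \<open>The base of the power in \<open>poly_bounded\<close>. The face is a single argument, so
  that faces are indexed by one variable of a finite type.\<close>

definition face_weight :: "'n set \<times> 'n set \<times> 'n set \<Rightarrow> real^'n \<Rightarrow> real" where
  "face_weight = (\<lambda>(A, S, B) p. (\<Prod>i\<in>A. 1 - p$i) * (\<Prod>i\<in>S. p$i) * (\<Prod>i\<in>S. 1 - p$i) * (\<Prod>i\<in>B. p$i))"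

lemma prod_le_factor:
  fixes f :: "'a \<Rightarrow> real"
  assumes "finite I" "i \<in> I" "\<And>j. j \<in> I \<Longrightarrow> 0 \<le> f j \<and> f j \<le> 1"
  shows "prod f I \<le> f i"
proof -
  have "prod f I = f i * prod f (I - {i})" using assms by (simp add: prod.remove)
  also have "\<dots> \<le> f i" using assms by (intro mult_left_le prod_le_1) auto
  finally show ?thesis .
qed

lemma face_weight_bounds:
  assumes p: "p \<in> cube"
  shows "0 \<le> face_weight (A, S, B) p" "face_weight (A, S, B) p \<le> 1"
    and "i \<in> A \<union> S \<Longrightarrow> face_weight (A, S, B) p \<le> 1 - p $ i"
    and "i \<in> S \<union> B \<Longrightarrow> face_weight (A, S, B) p \<le> p $ i"
proof -
  define a b c d where abcd: "a = (\<Prod>i\<in>A. 1 - p$i)" "b = (\<Prod>i\<in>S. p$i)" "c = (\<Prod>i\<in>S. 1 - p$i)" "d = (\<Prod>i\<in>B. p$i)"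
  have p': "0 \<le> p $ i" "p $ i \<le> 1" for i using p by (auto simp: cube_def)
  have bounds: "0 \<le> a" "a \<le> 1" "0 \<le> b" "b \<le> 1" "0 \<le> c" "c \<le> 1" "0 \<le> d" "d \<le> 1"
    unfolding abcd by (auto intro!: prod_nonneg prod_le_1 simp: p')
  have w: "face_weight (A, S, B) p = a * b * c * d" by (simp add: face_weight_def abcd)
  have ab: "0 \<le> a * b" "a * b \<le> a" "a * b \<le> b" and abc: "0 \<le> a * b * c" "a * b * c \<le> a * b" "a * b * c \<le> c"
    using bounds mult_le_one[of a b]
    by (auto intro!: mult_left_le mult_left_le_one_le)
  have le: "a * b * c * d \<le> a * b * c" "a * b * c * d \<le> d" "0 \<le> a * b * c * d"
    using bounds ab abc mult_le_one[of a b] by (auto intro!: mult_left_le mult_left_le_one_le)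
  show "0 \<le> face_weight (A, S, B) p" "face_weight (A, S, B) p \<le> 1"
    unfolding w using le bounds by auto
  show "face_weight (A, S, B) p \<le> 1 - p $ i" if "i \<in> A \<union> S"
  proof -
    have "a \<le> 1 - p $ i \<or> c \<le> 1 - p $ i"
      using that unfolding abcd by (auto intro!: prod_le_factor simp: p')
    then show ?thesis unfolding w using le ab abc by linarith
  qed
  show "face_weight (A, S, B) p \<le> p $ i" if "i \<in> S \<union> B"
  proof -
    have "b \<le> p $ i \<or> d \<le> p $ i"
      using that unfolding abcd by (auto intro!: prod_le_factor simp: p')
    then show ?thesis unfolding w using le ab abc by linarith
  qed
qed

lemma poly_bounded_iff:
  "poly_bounded K h \<longleftrightarrow> (\<exists>(m::nat) c. c > 0 \<and> (\<forall>A S B. is_partition3 A S B \<longrightarrow>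
     (\<exists>q\<in>K \<inter> open_face A S B. h q > 0) \<longrightarrow> (\<forall>p\<in>K. c * face_weight (A, S, B) p ^ m \<le> h p)))"
  by (simp add: poly_bounded_def face_weight_def)

text \<open>A coin edge that is possible at one point of the face has a probability that occurs as a
  factor of the face weight; a constant edge is bounded below by its own value.\<close>

lemma bf_edge_lower_bound:
  assumes "bf_wf T" "is_partition3 A S B" "q \<in> open_face A S B" "0 < bf_edge (T w) q c"
  shows "\<exists>e>0. \<forall>p\<in>cube. e * face_weight (A, S, B) p \<le> bf_edge (T w) p c"
proof (cases "T w")
  case (Leaf b)
  with assms show ?thesis by simp
next
  case (Coin i)
  have i: "i \<in> A \<union> S \<union> B" using assms by (auto simp: is_partition3_def)
  show ?thesis
  proof (cases c)
    case True
    with Coin assms i have "i \<in> S \<union> B" by (auto simp: open_face_def)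
    then have "face_weight (A, S, B) p \<le> p $ i" if "p \<in> cube" for p
      by (rule face_weight_bounds(4)[OF that])
    with Coin True show ?thesis by (intro exI[of _ 1]) simp
  next
    case False
    with Coin assms i have "i \<in> A \<union> S" by (auto simp: open_face_def)
    then have "face_weight (A, S, B) p \<le> 1 - p $ i" if "p \<in> cube" for p
      by (rule face_weight_bounds(3)[OF that])
    with Coin False show ?thesis by (intro exI[of _ 1]) simp
  qed
next
  case (Const a)
  have "bf_edge (T w) q c * face_weight (A, S, B) p \<le> bf_edge (T w) q c" if "p \<in> cube" for p
    using assms(4) face_weight_bounds(1,2)[OF that, of A S B] by (intro mult_left_le) auto
  with assms(4) Const show ?thesis by (intro exI[of _ "bf_edge (T w) q c"]) auto
qed

text \<open>The edge bounds multiply along the path, each edge contributing one factor of the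
  weight.\<close>

lemma bf_path_prob_lower_bound:
  assumes "bf_wf T" "is_partition3 A S B" "q \<in> open_face A S B" "q \<in> cube" "0 < bf_path_prob T q w"
  shows "\<exists>e>0. \<forall>p\<in>cube. e * face_weight (A, S, B) p ^ length w \<le> bf_path_prob T p w"
  using assms(1,5)
proof (induction w arbitrary: T)
  case Nil
  show ?case by (intro exI[of _ 1]) auto
next
  case (Cons c w)
  note wf = bf_wf_child[OF Cons.prems(1), of c]
  have "0 \<le> bf_edge (T []) q c" "0 \<le> bf_path_prob (child T c) q w"
    using bf_edge_nonneg bf_path_prob_nonneg wf Cons.prems(1) assms(4) by blast+
  with Cons.prems(2) have pos: "0 < bf_edge (T []) q c" "0 < bf_path_prob (child T c) q w"
    by (auto simp: less_le)
  obtain e1 where e1: "e1 > 0" "\<forall>p\<in>cube. e1 * face_weight (A, S, B) p \<le> bf_edge (T []) p c"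
    using bf_edge_lower_bound[OF Cons.prems(1) assms(2,3) pos(1)] by blast
  obtain e2 where e2: "e2 > 0" "\<forall>p\<in>cube. e2 * face_weight (A, S, B) p ^ length w \<le> bf_path_prob (child T c) p w"
    using Cons.IH[OF wf pos(2)] by blast
  show ?case
  proof (intro exI[of _ "e1 * e2"] conjI ballI)
    fix p :: "real^'a" assume p: "p \<in> cube"
    have "(e1 * face_weight (A, S, B) p) * (e2 * face_weight (A, S, B) p ^ length w)
      \<le> bf_edge (T []) p c * bf_path_prob (child T c) p w"
      using e1 e2 p face_weight_bounds(1,2)[OF p, of A S B]
      by (intro mult_mono) (auto simp: bf_edge_nonneg Cons.prems(1))
    then show "e1 * e2 * face_weight (A, S, B) p ^ length (c # w) \<le> bf_path_prob T p (c # w)"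
      by (simp add: mult_ac)
  qed (use e1 e2 in auto)
qed

text \<open>If \<open>f q > 0\<close>, some leaf labelled \<open>True\<close> is reached from
  \<open>q\<close> with positive probability. The probability of that one path bounds
  \<open>f\<close> from below on all of \<open>K\<close>, and there are finitely many faces.\<close>

lemma implementable_imp_poly_bounded:
  fixes K :: "(real^'n) set"
  assumes K: "K \<subseteq> cube" and f: "implementable K f"
  shows "poly_bounded K f"
proof -
  obtain T where T: "bf_wf T" "\<And>p. p \<in> K \<Longrightarrow> out True T p = f p" "\<And>p. p \<in> K \<Longrightarrow> out False T p = 1 - f p"
    using implementableE[OF f K] by blast
  define good where "good = (\<lambda>(A, S, B). is_partition3 A S B \<and> (\<exists>q\<in>K \<inter> open_face A S B. f q > 0))"
  \<comment> \<open>Positivity of \<open>c\<close> is demanded for every triple, good or not, so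
    that the minimum of the chosen constants is positive.\<close>
  define bound where "bound t m c \<longleftrightarrow> c > 0 \<and> (good t \<longrightarrow> (\<forall>p\<in>K. c * face_weight t p ^ m \<le> f p))"
    for t :: "'n set \<times> 'n set \<times> 'n set" and m :: nat and c :: real
  have "\<exists>m c. bound t m c" for t :: "'n set \<times> 'n set \<times> 'n set"
  proof (cases "good t")
    case True
    obtain A S B where t: "t = (A, S, B)" by (cases t)
    with True obtain q where q: "is_partition3 A S B" "q \<in> K" "q \<in> open_face A S B" "f q > 0"
      by (auto simp: good_def)
    have qc: "q \<in> cube" using q K by auto
    have "\<exists>w\<in>bf_leaves T True. bf_path_prob T q w \<noteq> 0"
    proof (rule ccontr)
      assume "\<not> ?thesis"
      then have "out True T q = 0" unfolding out_def by (intro infsum_0) auto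
      then show False using T(2)[OF q(2)] q(4) by simp
    qed
    then obtain w where w: "w \<in> bf_leaves T True" "0 < bf_path_prob T q w"
      using bf_path_prob_nonneg[OF T(1) qc] by (auto simp: less_le)
    obtain e where e: "e > 0" "\<forall>p\<in>cube. e * face_weight t p ^ length w \<le> bf_path_prob T p w"
      using bf_path_prob_lower_bound[OF T(1) q(1,3) qc w(2)] t by blast
    have "e * face_weight t p ^ length w \<le> f p" if p: "p \<in> K" for p
    proof -
      have pc: "p \<in> cube" using p K by auto
      have "sum (bf_path_prob T p) {w} \<le> out True T p"
        unfolding out_def using w(1) bf_path_prob_nonneg[OF T(1) pc]
        by (intro finite_sum_le_infsum bf_path_prob_summable T pc) auto
      then have "bf_path_prob T p w \<le> f p" by (simp add: T p)
      with e(2) pc show ?thesis by force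
    qed
    with e(1) show ?thesis unfolding bound_def by blast
  qed (auto simp: bound_def intro: exI[of _ 1])
  then obtain M C where MC_bound: "\<And>t. bound t (M t) (C t)"
    by metis
  then have C: "\<And>t. C t > 0"
    and MC: "\<And>t p. good t \<Longrightarrow> p \<in> K \<Longrightarrow> C t * face_weight t p ^ M t \<le> f p"
    by (auto simp: bound_def)
  have fin: "finite (range C)" "finite (range M)" by simp_all
  show ?thesis unfolding poly_bounded_iff
  proof (intro exI conjI allI impI ballI)
    show "Min (range C) > 0" using C by (subst Min_gr_iff) auto
    fix A S B p
    assume good: "is_partition3 A S B" "\<exists>q\<in>K \<inter> open_face A S B. f q > 0" and p: "p \<in> K"
    let ?t = "(A, S, B)"
    have pc: "p \<in> cube" using p K by auto
    note wb = face_weight_bounds(1,2)[OF pc, of A S B]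
    \<comment> \<open>The weight lies in the unit interval, so raising the exponent to the common
      maximum only lowers the power.\<close>
    have "Min (range C) * face_weight ?t p ^ Max (range M) \<le> C ?t * face_weight ?t p ^ M ?t"
      using wb fin C[of ?t] by (intro mult_mono power_decreasing) auto
    also have "\<dots> \<le> f p" using good by (intro MC p) (auto simp: good_def)
    finally show "Min (range C) * face_weight ?t p ^ Max (range M) \<le> f p" .
  qed
qed

subsection \<open>Uniform approximation\<close>

lemma implementable_convex:
  fixes K :: "(real^'n) set"
  assumes K: "K \<subseteq> cube" and "implementable K f" "implementable K g" and "0 \<le> c" "c \<le> 1"
  shows "implementable K (\<lambda>p. c * f p + (1 - c) * g p)"
  using implementable_ite[OF K implementable_const[OF K assms(4,5)] assms(2,3)] .

text \<open>Implementable functions have values in the unit interval and are not closed under sums.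
  Rescaling from \<open>[-M, M]\<close>, with \<open>M\<close> free, yields a class closed under
  sums and products.\<close>

definition scalable :: "(real^'n) set \<Rightarrow> (real^'n \<Rightarrow> real) \<Rightarrow> bool" where
  "scalable K q \<longleftrightarrow> (\<exists>M>0. implementable K (\<lambda>p. (q p + M) / (2 * M)))"

context
  fixes K :: "(real^'n) set"
  assumes K: "K \<subseteq> cube"
begin

lemma scalable_const: "scalable K (\<lambda>_. c)"
proof -
  have "implementable K (\<lambda>_. (c + (\<bar>c\<bar> + 1)) / (2 * (\<bar>c\<bar> + 1)))"
    by (rule implementable_const[OF K]) (auto simp: divide_simps)
  then show ?thesis unfolding scalable_def by (intro exI[of _ "\<bar>c\<bar> + 1"]) auto
qed

lemma scalable_coord: "scalable K (\<lambda>p. p $ i)"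
proof -
  have "implementable K (\<lambda>p. 1/2 * p $ i + (1 - 1/2) * 1)"
    by (intro implementable_convex[OF K] implementable_coord[OF K] implementable_const[OF K]) auto
  then have "implementable K (\<lambda>p. (p $ i + 1) / (2 * 1))"
    by (rule implementable_cong) simp
  then show ?thesis unfolding scalable_def by (intro exI[of _ 1]) auto
qed

lemma scalable_add:
  assumes "scalable K q1" "scalable K q2"
  shows "scalable K (\<lambda>p. q1 p + q2 p)"
proof -
  obtain M1 M2 where M: "M1 > 0" "M2 > 0"
    and i: "implementable K (\<lambda>p. (q1 p + M1) / (2 * M1))" "implementable K (\<lambda>p. (q2 p + M2) / (2 * M2))"
    using assms unfolding scalable_def by blast
  \<comment> \<open>With weights proportional to \<open>M1\<close> and \<open>M2\<close> the two
    numerators get the common denominator \<open>2 * (M1 + M2)\<close>.\<close>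
  define c where "c = M1 / (M1 + M2)"
  have c: "0 \<le> c" "c \<le> 1" "1 - c = M2 / (M1 + M2)" using M by (auto simp: c_def field_simps)
  have "implementable K (\<lambda>p. (q1 p + q2 p + (M1 + M2)) / (2 * (M1 + M2)))"
  proof (rule implementable_cong[OF implementable_convex[OF K i c(1,2)]])
    fix p
    have "c * ((q1 p + M1) / (2 * M1)) = (q1 p + M1) / (2 * (M1 + M2))"
      "(1 - c) * ((q2 p + M2) / (2 * M2)) = (q2 p + M2) / (2 * (M1 + M2))"
      using M unfolding c(3) by (simp_all add: c_def)
    then show "c * ((q1 p + M1) / (2 * M1)) + (1 - c) * ((q2 p + M2) / (2 * M2))
        = (q1 p + q2 p + (M1 + M2)) / (2 * (M1 + M2))"
      by (simp add: add_divide_distrib)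
  qed
  then show ?thesis unfolding scalable_def using M by (intro exI[of _ "M1 + M2"]) auto
qed

text \<open>In the coordinates \<open>x = (1 + y) / 2\<close> the product becomes exclusive nor:
  \<open>(1 + y\<^sub>1 y\<^sub>2) / 2 = x\<^sub>1 x\<^sub>2 + (1 - x\<^sub>1) (1 - x\<^sub>2)\<close>.\<close>

lemma scalable_mult:
  assumes "scalable K q1" "scalable K q2"
  shows "scalable K (\<lambda>p. q1 p * q2 p)"
proof -
  obtain M1 M2 where M: "M1 > 0" "M2 > 0"
    and i: "implementable K (\<lambda>p. (q1 p + M1) / (2 * M1))" "implementable K (\<lambda>p. (q2 p + M2) / (2 * M2))"
    using assms unfolding scalable_def by blast
  have "implementable K (\<lambda>p. (q1 p * q2 p + M1 * M2) / (2 * (M1 * M2)))"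
    by (rule implementable_cong[OF implementable_ite[OF K i implementable_compl[OF K i(2)]]])
       (use M in \<open>simp add: field_simps\<close>)
  then show ?thesis unfolding scalable_def using M by (intro exI[of _ "M1 * M2"]) auto
qed

lemma scalable_linear:
  fixes q :: "real^'n \<Rightarrow> real"
  assumes "bounded_linear q"
  shows "scalable K q"
proof -
  have q_eq: "q = (\<lambda>p. \<Sum>i\<in>UNIV. p $ i * q (axis i 1))"
  proof
    fix p
    interpret bounded_linear q by fact
    have "q p = q (\<Sum>i\<in>UNIV. p $ i *\<^sub>R axis i 1)"
      using basis_expansion[of p] by (simp add: scalar_mult_eq_scaleR)
    then show "q p = (\<Sum>i\<in>UNIV. p $ i * q (axis i 1))"
      by (simp add: sum scaleR)
  qed
  have "scalable K (\<lambda>p. \<Sum>i\<in>I. p $ i * q (axis i 1))" if "finite I" for I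
    using that
    by (induction I rule: finite_induct)
       (simp_all add: scalable_const scalable_add scalable_mult scalable_coord)
  from this[OF finite_class.finite_UNIV] show ?thesis
    by (subst q_eq)
qed

lemma scalable_polynomial: "real_polynomial_function q \<Longrightarrow> scalable K q"
  by (induction rule: real_polynomial_function.induct)
     (auto intro: scalable_linear scalable_const scalable_add scalable_mult)

text \<open>This is the probability of a 1 when \<open>x\<close> is sampled \<open>n\<close> times
  and, after \<open>k\<close> successes, a coin of bias \<open>a k\<close> is tossed. A first
  success shifts the coefficients to \<open>a (Suc k)\<close>, which gives the induction.\<close>

lemma implementable_Bernstein:
  assumes x: "implementable K x" and a: "\<And>k. 0 \<le> a k \<and> a k \<le> 1"
  shows "implementable K (\<lambda>p. \<Sum>k\<le>n. a k * Bernstein n k (x p))"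
  using a
proof (induction n arbitrary: a)
  case 0
  then show ?case by (simp add: Bernstein_def implementable_const[OF K])
next
  case (Suc n)
  have rec: "(\<Sum>k\<le>Suc n. a k * Bernstein (Suc n) k y) =
    y * (\<Sum>k\<le>n. a (Suc k) * Bernstein n k y) + (1 - y) * (\<Sum>k\<le>n. a k * Bernstein n k y)" for y :: real
  proof -
    \<comment> \<open>Pascal's rule; for \<open>k = n\<close> the last term vanishes with its
      binomial coefficient.\<close>
    have B: "Bernstein (Suc n) (Suc k) y = y * Bernstein n k y + (1 - y) * Bernstein n (Suc k) y" if "k \<le> n" for k
    proof (cases "k = n")
      case False
      with that have "n - k = Suc (n - Suc k)" by simp
      then show ?thesis by (simp add: Bernstein_def algebra_simps)
    qed (simp add: Bernstein_def)
    have "(\<Sum>k\<le>Suc n. a k * Bernstein (Suc n) k y) =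
      a 0 * Bernstein (Suc n) 0 y + (\<Sum>k\<le>n. a (Suc k) * (y * Bernstein n k y + (1 - y) * Bernstein n (Suc k) y))"
      by (subst sum.atMost_Suc_shift) (simp add: B)
    also have "\<dots> = y * (\<Sum>k\<le>n. a (Suc k) * Bernstein n k y)
      + (1 - y) * (a 0 * Bernstein n 0 y + (\<Sum>k\<le>n. a (Suc k) * Bernstein n (Suc k) y))"
      by (simp add: Bernstein_def algebra_simps sum.distrib sum_distrib_left sum_subtractf)
    also have "a 0 * Bernstein n 0 y + (\<Sum>k\<le>n. a (Suc k) * Bernstein n (Suc k) y) = (\<Sum>k\<le>Suc n. a k * Bernstein n k y)"
      by (subst sum.atMost_Suc_shift) simp
    also have "\<dots> = (\<Sum>k\<le>n. a k * Bernstein n k y)"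
      by (simp add: Bernstein_def)
    finally show ?thesis .
  qed
  show ?case unfolding rec
    by (intro implementable_ite[OF K x] Suc.IH Suc.prems)
qed

text \<open>A polynomial \<open>q\<close> close to \<open>f\<close> may leave the unit interval, and
  only its rescaling \<open>x\<close> is implementable. A Bernstein polynomial in \<open>x\<close>
  approximately undoes the rescaling; each of the two approximations costs
  \<open>e/2\<close>.\<close>

lemma implementable_approx:
  assumes "compact K" "continuous_on K f" and f: "\<And>p. p \<in> K \<Longrightarrow> 0 \<le> f p \<and> f p \<le> 1" and e: "0 < e"
  obtains h where "implementable K h" "\<And>p. p \<in> K \<Longrightarrow> \<bar>h p - f p\<bar> \<le> e"
proof -
  obtain q where q: "real_polynomial_function q" "\<And>p. p \<in> K \<Longrightarrow> \<bar>f p - q p\<bar> < e/2"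
    using Stone_Weierstrass_real_polynomial_function[OF assms(1,2), of "e/2"] e by auto
  obtain M where M: "M > 0" and x: "implementable K (\<lambda>p. (q p + M) / (2 * M))"
    using scalable_polynomial[OF q(1)] unfolding scalable_def by blast
  define x where "x p = (q p + M) / (2 * M)" for p
  \<comment> \<open>Inverts the rescaling and clamps to the unit interval, so the values of
    \<open>\<phi>\<close> are admissible Bernstein coefficients.\<close>
  define \<phi> where "\<phi> t = max 0 (min 1 (2 * M * t - M))" for t :: real
  have "continuous_on {0..1} \<phi>"
    unfolding \<phi>_def by (intro continuous_intros)
  from Bernstein_Weierstrass[OF this, of "e/2"] e obtain N where
    N: "\<And>t. t \<in> {0..1} \<Longrightarrow> \<bar>\<phi> t - (\<Sum>k\<le>N. \<phi> (k / N) * Bernstein N k t)\<bar> < e/2"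
    by auto
  have impl_x: "implementable K x" using x unfolding x_def .
  show thesis
  proof
    show "implementable K (\<lambda>p. \<Sum>k\<le>N. \<phi> (k / N) * Bernstein N k (x p))"
      by (rule implementable_Bernstein[OF impl_x]) (auto simp: \<phi>_def)
    fix p assume p: "p \<in> K"
    have "x p \<in> {0..1}" using implementable_bounds[OF impl_x K p] by simp
    \<comment> \<open>\<open>\<phi> (x p)\<close> is \<open>q p\<close> clamped to the unit
      interval, and clamping does not increase the distance to a value in that interval.\<close>
    moreover have "\<bar>\<phi> (x p) - f p\<bar> \<le> \<bar>f p - q p\<bar>"
      using f[OF p] M by (auto simp: \<phi>_def x_def)
    ultimately show "\<bar>(\<Sum>k\<le>N. \<phi> (k / N) * Bernstein N k (x p)) - f p\<bar> \<le> e"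
      using N[of "x p"] q(2)[OF p] by linarith
  qed
qed

end

subsection \<open>Expansion into a countable mixture\<close>

text \<open>Agreement on 1 costs at most \<open>f / 2\<close>: one factor \<open>r\<close> is at
  most \<open>C * f\<close>, the other \<open>M\<close> are at most \<open>1 - d\<close>. Otherwise
  \<open>h\<close> is asked only if some sample is 1, so its additive error \<open>e\<close> is
  weighted by \<open>b\<close>, which is at most a multiple of \<open>f\<close>, and becomes a
  relative error.\<close>

lemma mixture_upper_bound:
  fixes r h f C d e :: real
  assumes r: "0 \<le> r" "r \<le> 1" "r \<le> C * f" and h: "0 \<le> h" "h \<le> f + e"
    and C: "C > 0" and f: "f \<ge> 0" and e: "0 \<le> e" "C * e * Suc M \<le> 1/2"
    and d: "r \<le> 1 - d" "C * (1 - d) ^ M \<le> 1/2"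
  shows "r ^ Suc M + (1 - r ^ Suc M - (1 - r) ^ Suc M) * h \<le> 2 * f"
proof -
  define b where "b = 1 - (1 - r) ^ Suc M"
  have "r ^ Suc M \<le> (C * f) * (1 - d) ^ M"
    using r d by (simp only: power_Suc) (intro mult_mono power_mono, auto)
  also have "\<dots> = f * (C * (1 - d) ^ M)" by simp
  also have "\<dots> \<le> f * (1/2)" using d f by (intro mult_left_mono)
  finally have 1: "r ^ Suc M \<le> f / 2" by simp
  have b: "0 \<le> b" "b \<le> 1" using r power_le_one[of "1 - r" "Suc M"] by (auto simp: b_def simp del: power_Suc)
  \<comment> \<open>Bernoulli's inequality gives the union bound for \<open>b\<close>, the
    probability of at least one 1 among \<open>Suc M\<close> samples.\<close>
  have "1 + real (Suc M) * (- r) \<le> (1 + (- r)) ^ Suc M"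
    using r by (intro Bernoulli_inequality) auto
  then have "b \<le> real (Suc M) * r" by (simp add: b_def)
  also have "\<dots> \<le> real (Suc M) * (C * f)" using r by (intro mult_left_mono) auto
  finally have "b * e \<le> real (Suc M) * (C * f) * e" using e by (intro mult_right_mono)
  also have "\<dots> = f * (C * e * Suc M)" by (simp add: algebra_simps)
  also have "\<dots> \<le> f * (1/2)" using e f by (intro mult_left_mono)
  finally have "b * e \<le> f / 2" by simp
  moreover have "b * f \<le> f" using b f by (intro mult_left_le_one_le)
  moreover have "b * h \<le> b * (f + e)" using b h by (intro mult_left_mono)
  ultimately have 2: "b * h \<le> f + f / 2" by (simp add: ring_distribs)
  have "(1 - r ^ Suc M - (1 - r) ^ Suc M) * h \<le> b * h"
    using h r unfolding b_def by (intro mult_right_mono) auto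
  with 1 2 show ?thesis by linarith
qed

lemma compact_positive_lower_bound:
  fixes s :: "'a::topological_space \<Rightarrow> real"
  assumes "compact K" "continuous_on K s" "\<And>p. p \<in> K \<Longrightarrow> 0 < s p"
  obtains d where "0 < d" "d \<le> 1" "\<And>p. p \<in> K \<Longrightarrow> d \<le> s p"
proof (cases "K = {}")
  case True
  then show ?thesis using that[of 1] by auto
next
  case False
  then obtain q where q: "q \<in> K" "\<And>p. p \<in> K \<Longrightarrow> s q \<le> s p"
    using continuous_attains_inf[OF assms(1) _ assms(2)] by blast
  \<comment> \<open>The cap at 1 keeps \<open>1 - d\<close> nonnegative, as a base of powers tending
    to 0.\<close>
  then show ?thesis using that[of "min 1 (s q)"] assms(3) by (auto simp: min_le_iff_disj)
qed

text \<open>For \<open>r\<close> with values in the unit interval, the conditions force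
  \<open>f\<close> and \<open>r\<close> to equal 0 at the same points and 1 at the same points. The
  constant \<open>C\<close> is existential because it grows with every residual while
  \<open>r\<close> stays fixed.\<close>

definition controlled :: "(real^'n) set \<Rightarrow> (real^'n \<Rightarrow> real) \<Rightarrow> (real^'n \<Rightarrow> real) \<Rightarrow> bool" where
  "controlled K r f \<longleftrightarrow> continuous_on K f \<and> (\<forall>p\<in>K. 0 \<le> f p \<and> f p \<le> 1) \<and>
     (\<exists>C>0. \<forall>p\<in>K. r p \<le> C * f p \<and> 1 - r p \<le> C * (1 - f p)) \<and>
     (\<forall>p\<in>K. (r p = 0 \<longrightarrow> f p = 0) \<and> (r p = 1 \<longrightarrow> f p = 1))"

context
  fixes K :: "(real^'n) set" and r :: "real^'n \<Rightarrow> real"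
  assumes cube: "K \<subseteq> cube" and compact: "compact K" and r: "implementable K r"
begin

text \<open>Where \<open>f\<close> is at most 1/2, the bound on \<open>1 - g\<close> is trivial and
  \<open>mixture_upper_bound\<close> gives the bound on \<open>g\<close>; where \<open>f\<close> is
  at least 1/2 the roles are exchanged.\<close>

lemma controlled_sandwich:
  assumes "controlled K r f"
  obtains g where "implementable K g" "\<And>p. p \<in> K \<Longrightarrow> g p \<le> 2 * f p" "\<And>p. p \<in> K \<Longrightarrow> 1 - g p \<le> 2 * (1 - f p)"
proof -
  have cont: "continuous_on K f" and f: "\<And>p. p \<in> K \<Longrightarrow> 0 \<le> f p \<and> f p \<le> 1"
    and zero: "\<And>p. p \<in> K \<Longrightarrow> r p = 0 \<Longrightarrow> f p = 0" "\<And>p. p \<in> K \<Longrightarrow> r p = 1 \<Longrightarrow> f p = 1"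
    using assms by (auto simp: controlled_def)
  obtain C where C: "C > 0" "\<And>p. p \<in> K \<Longrightarrow> r p \<le> C * f p" "\<And>p. p \<in> K \<Longrightarrow> 1 - r p \<le> C * (1 - f p)"
    using assms unfolding controlled_def by blast
  note contr = implementable_imp_continuous_on[OF cube r]
  note rb = implementable_bounds[OF r cube]
  have comp: "compact {p \<in> K. f p \<le> 1/2}" "compact {p \<in> K. 1/2 \<le> f p}"
    using compact_Int_closed[OF compact continuous_on_closed_Collect_le[OF cont
        continuous_on_const[where c = "1/2"] compact_imp_closed[OF compact]]]
      compact_Int_closed[OF compact continuous_on_closed_Collect_le[OF
        continuous_on_const[where c = "1/2"] cont compact_imp_closed[OF compact]]]
    by (simp_all only: Int_absorb1 Collect_subset)
  \<comment> \<open>\<open>r p = 1\<close> would force \<open>f p = 1\<close>, so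
    \<open>1 - r\<close> is positive on this compact part and hence bounded away from 0
    there.\<close>
  have low: "0 < 1 - r p" if "p \<in> {p \<in> K. f p \<le> 1/2}" for p
    using that rb(2)[of p] zero(2)[of p] by (cases "r p = 1") auto
  have high: "0 < r p" if "p \<in> {p \<in> K. 1/2 \<le> f p}" for p
    using that rb(1)[of p] zero(1)[of p] by (cases "r p = 0") auto
  have cont1: "continuous_on {p \<in> K. f p \<le> 1/2} (\<lambda>p. 1 - r p)"
    by (intro continuous_intros continuous_on_subset[OF contr]) auto
  have cont2: "continuous_on {p \<in> K. 1/2 \<le> f p} r"
    by (rule continuous_on_subset[OF contr]) auto
  obtain d1 where d1: "0 < d1" "d1 \<le> 1" "\<And>p. p \<in> {p \<in> K. f p \<le> 1/2} \<Longrightarrow> d1 \<le> 1 - r p"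
    using compact_positive_lower_bound[OF comp(1) cont1 low] by blast
  obtain d2 where d2: "0 < d2" "d2 \<le> 1" "\<And>p. p \<in> {p \<in> K. 1/2 \<le> f p} \<Longrightarrow> d2 \<le> r p"
    using compact_positive_lower_bound[OF comp(2) cont2 high] by blast
  define d where "d = min d1 d2"
  have d: "0 < d" "d \<le> 1" "\<And>p. p \<in> K \<Longrightarrow> f p \<le> 1/2 \<Longrightarrow> r p \<le> 1 - d" "\<And>p. p \<in> K \<Longrightarrow> 1/2 \<le> f p \<Longrightarrow> 1 - r p \<le> 1 - d"
    using d1(1,2) d2(1,2) d1(3) d2(3) by (force simp: d_def)+
  have "(\<lambda>M. C * (1 - d) ^ M) \<longlonglongrightarrow> C * 0"
    using d by (intro tendsto_intros LIMSEQ_realpow_zero) auto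
  then have "\<forall>\<^sub>F M in sequentially. C * (1 - d) ^ M < 1/2"
    by (rule order_tendstoD) simp
  then obtain M where M: "C * (1 - d) ^ M \<le> 1/2"
    unfolding eventually_sequentially by (meson less_imp_le order_refl)
  \<comment> \<open>The number of samples is fixed first; this accuracy then makes
    \<open>C * e * Suc M\<close> equal to 1/2.\<close>
  define e where "e = 1 / (2 * C * Suc M)"
  have e: "0 < e" "C * e * Suc M \<le> 1/2" using C(1) by (simp_all add: e_def del: of_nat_Suc)
  obtain h where h: "implementable K h" "\<And>p. p \<in> K \<Longrightarrow> \<bar>h p - f p\<bar> \<le> e"
    using implementable_approx[OF cube compact cont f e(1)] by blast
  note hb = implementable_bounds[OF h(1) cube]
  define g where "g p = r p ^ Suc M + (1 - r p ^ Suc M - (1 - r p) ^ Suc M) * h p" for p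
  show thesis
  proof
    note compl = implementable_compl[OF cube]
    note pow = implementable_power[OF cube, where m = M]
    \<comment> \<open>One sample of \<open>r\<close> is drawn first, then \<open>M\<close> more are
      compared with it; \<open>h\<close> is asked if they do not all agree.\<close>
    have "implementable K (\<lambda>p. r p * (r p ^ M * 1 + (1 - r p ^ M) * h p)
      + (1 - r p) * ((1 - r p) ^ M * 0 + (1 - (1 - r p) ^ M) * h p))"
      by (intro implementable_ite[OF cube] r h pow compl implementable_const[OF cube]) auto
    then show "implementable K g"
      by (rule implementable_cong) (simp add: g_def algebra_simps)
    fix p assume p: "p \<in> K"
    \<comment> \<open>Replacing \<open>r\<close> and \<open>h\<close> by their complements turns
      \<open>g\<close> into \<open>1 - g\<close>, so one estimate serves both sides.\<close>
    have g_alt: "1 - g p = (1 - r p) ^ Suc M + (1 - (1 - r p) ^ Suc M - (1 - (1 - r p)) ^ Suc M) * (1 - h p)"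
      by (simp add: g_def algebra_simps)
    have nn: "0 \<le> (1 - r p ^ Suc M - (1 - r p) ^ Suc M)"
    proof -
      have "x ^ Suc M \<le> x" if "0 \<le> x" "x \<le> 1" for x :: real
        using power_decreasing[of 1 "Suc M" x] that by simp
      from this[of "r p"] this[of "1 - r p"] rb[OF p] show ?thesis by linarith
    qed
    have "0 \<le> g p" unfolding g_def using nn hb[OF p] rb[OF p] by auto
    moreover have "0 \<le> 1 - g p" unfolding g_alt
    proof (intro add_nonneg_nonneg mult_nonneg_nonneg)
      show "0 \<le> 1 - (1 - r p) ^ Suc M - (1 - (1 - r p)) ^ Suc M" using nn by simp
    qed (use hb[OF p] rb[OF p] in auto)
    ultimately have gb: "0 \<le> g p" "g p \<le> 1" by auto
    show "g p \<le> 2 * f p"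
    proof (cases "f p \<le> 1/2")
      case True
      show ?thesis unfolding g_def
        using rb[OF p] hb[OF p] h(2)[OF p] C d(3)[OF p True] e M f p
        by (intro mixture_upper_bound[where C = C and d = d and e = e]) auto
    qed (use gb in auto)
    show "1 - g p \<le> 2 * (1 - f p)"
    proof (cases "1/2 \<le> f p")
      case True
      show ?thesis unfolding g_alt
        using rb[OF p] hb[OF p] h(2)[OF p] C d(4)[OF p True] e M f p
        by (intro mixture_upper_bound[where C = C and d = d and e = e]) auto
    qed (use gb in auto)
  qed
qed

text \<open>From \<open>g <= 2 * f\<close> follows \<open>4 * f - g >= 2 * f\<close>, so the
  residual keeps at least 2/3 of \<open>f\<close>, and likewise for the complements. It therefore
  stays in the unit interval, and \<open>3/2 * C\<close> is a valid constant for it.\<close>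

lemma controlled_step:
  assumes "controlled K r f"
  obtains g f' where "implementable K g" "controlled K r f'" "\<And>p. p \<in> K \<Longrightarrow> f p = 1/4 * g p + 3/4 * f' p"
proof -
  obtain g where g: "implementable K g" "\<And>p. p \<in> K \<Longrightarrow> g p \<le> 2 * f p" "\<And>p. p \<in> K \<Longrightarrow> 1 - g p \<le> 2 * (1 - f p)"
    using controlled_sandwich[OF assms] by blast
  have cont: "continuous_on K f" and f: "\<And>p. p \<in> K \<Longrightarrow> 0 \<le> f p \<and> f p \<le> 1"
    and zero: "\<And>p. p \<in> K \<Longrightarrow> r p = 0 \<Longrightarrow> f p = 0" "\<And>p. p \<in> K \<Longrightarrow> r p = 1 \<Longrightarrow> f p = 1"
    using assms by (auto simp: controlled_def)
  obtain C where C: "C > 0" "\<And>p. p \<in> K \<Longrightarrow> r p \<le> C * f p" "\<And>p. p \<in> K \<Longrightarrow> 1 - r p \<le> C * (1 - f p)"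
    using assms unfolding controlled_def by blast
  define f' where "f' p = (4 * f p - g p) / 3" for p
  have gb: "0 \<le> g p" "g p \<le> 1" if "p \<in> K" for p using implementable_bounds[OF g(1) cube that] .
  have le: "2/3 * f p \<le> f' p" "2/3 * (1 - f p) \<le> 1 - f' p" if "p \<in> K" for p
    using g(2,3)[OF that] by (auto simp: f'_def field_simps)
  show thesis
  proof
    show "controlled K r f'" unfolding controlled_def
    proof (intro conjI ballI impI)
      show "continuous_on K f'" unfolding f'_def
        by (intro continuous_intros cont implementable_imp_continuous_on cube g) simp
      show "\<exists>C>0. \<forall>p\<in>K. r p \<le> C * f' p \<and> 1 - r p \<le> C * (1 - f' p)"
      proof (intro exI conjI ballI)
        fix p assume p: "p \<in> K"
        have "C * y \<le> 3/2 * C * z" if "2/3 * y \<le> z" for y z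
          using mult_left_mono[OF that, of "3/2 * C"] C(1) by simp
        from this[OF le(1)[OF p]] this[OF le(2)[OF p]]
        show "r p \<le> 3/2 * C * f' p" "1 - r p \<le> 3/2 * C * (1 - f' p)"
          using C(2,3)[OF p] by linarith+
      qed (use C in auto)
      fix p assume p: "p \<in> K"
      show "0 \<le> f' p" "f' p \<le> 1" using le[OF p] f[OF p] by auto
      show "f' p = 0" if "r p = 0" using zero(1)[OF p that] g(2)[OF p] gb[OF p] by (simp add: f'_def)
      show "f' p = 1" if "r p = 1" using zero(2)[OF p that] g(3)[OF p] gb[OF p] by (simp add: f'_def)
    qed
  qed (use g in \<open>auto simp: f'_def field_simps\<close>)
qed

lemma controlled_imp_implementable:
  assumes "controlled K r f"
  shows "implementable K f"
proof -
  define Q where "Q f f' = (\<exists>g. implementable K g \<and> (\<forall>p\<in>K. f p = 1/4 * g p + 3/4 * f' p))" for f f'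
  \<comment> \<open>The clause for \<open>n = 0\<close> pins the start of the sequence of residuals
    to \<open>f\<close>.\<close>
  have "\<exists>F. \<forall>n. (controlled K r (F n) \<and> (n = 0 \<longrightarrow> F n = f)) \<and> Q (F n) (F (Suc n))"
  proof (rule dependent_nat_choice)
    show "\<exists>x. controlled K r x \<and> ((0::nat) = 0 \<longrightarrow> x = f)" using assms by blast
    fix x and n :: nat assume "controlled K r x \<and> (n = 0 \<longrightarrow> x = f)"
    then obtain g f' where "implementable K g" "controlled K r f'" "\<And>p. p \<in> K \<Longrightarrow> x p = 1/4 * g p + 3/4 * f' p"
      using controlled_step[of x] by blast
    then show "\<exists>y. (controlled K r y \<and> (Suc n = 0 \<longrightarrow> y = f)) \<and> Q x y"
      unfolding Q_def by blast
  qed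
  then obtain F where F: "\<And>n. controlled K r (F n)" "F 0 = f" "\<And>n. Q (F n) (F (Suc n))"
    by blast
  from F(3) obtain G where G: "\<And>n. implementable K (G n)" "\<And>n p. p \<in> K \<Longrightarrow> F n p = 1/4 * G n p + 3/4 * F (Suc n) p"
    unfolding Q_def by metis
  have "implementable K (F 0)"
    by (rule implementable_mixture[where f = F and g = G, OF cube G(1) _ G(2)]) (use F(1) in \<open>auto simp: controlled_def\<close>)
  then show ?thesis by (simp add: F(2))
qed

end

section \<open>From polynomial bounds to a controlling function\<close>

lemma implementable_face_weight:
  fixes K :: "(real^'n) set"
  assumes K: "K \<subseteq> cube"
  shows "implementable K (face_weight t)"
proof -
  obtain A S B where t: "t = (A, S, B)" by (cases t)
  show ?thesis unfolding t face_weight_def prod.case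
    by (intro implementable_mult[OF K] implementable_prod[OF K] implementable_compl[OF K] implementable_coord[OF K]) auto
qed

text \<open>Each good face gives a minorant, a constant times a power of its weight. Averaging them
  one face at a time keeps a minorant, which is positive wherever \<open>f\<close> is because the
  weight of the face containing \<open>p\<close> is positive at \<open>p\<close>.\<close>

lemma poly_bounded_minorant:
  fixes K :: "(real^'n) set"
  assumes K: "K \<subseteq> cube" and pb: "poly_bounded K f" and f: "\<And>p. p \<in> K \<Longrightarrow> 0 \<le> f p \<and> f p \<le> 1"
  obtains u where "implementable K u" "\<And>p. p \<in> K \<Longrightarrow> u p \<le> f p" "\<And>p. p \<in> K \<Longrightarrow> 0 < f p \<Longrightarrow> 0 < u p"
proof -
  define good where "good = (\<lambda>(A, S, B). is_partition3 A S B \<and> (\<exists>q\<in>K \<inter> open_face A S B. f q > 0))"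
  obtain m c where c: "c > 0" "\<And>t p. good t \<Longrightarrow> p \<in> K \<Longrightarrow> c * face_weight t p ^ m \<le> f p"
    using pb unfolding poly_bounded_iff good_def by force
  \<comment> \<open>The constant must be at most 1 to be implementable.\<close>
  define c' where "c' = min 1 c"
  have c': "0 < c'" "c' \<le> 1" "c' \<le> c" using c(1) by (auto simp: c'_def)
  have wb: "0 \<le> face_weight t p" if "p \<in> K" for t p
    using face_weight_bounds(1)[of p] that K by (cases t) auto
  have ex: "\<exists>u. implementable K u \<and> (\<forall>p\<in>K. u p \<le> f p) \<and> (\<forall>p\<in>K. (\<exists>t\<in>P. 0 < face_weight t p) \<longrightarrow> 0 < u p)"
    if "finite P" "P \<subseteq> Collect good" for P
    using that
  proof (induction P rule: finite_induct)
    case empty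
    show ?case using f by (intro exI[of _ "\<lambda>_. 0"]) (auto simp: implementable_const[OF K])
  next
    case (insert t P)
    then obtain u where u: "implementable K u" "\<forall>p\<in>K. u p \<le> f p"
      "\<forall>p\<in>K. (\<exists>t\<in>P. 0 < face_weight t p) \<longrightarrow> 0 < u p" by auto
    define v where "v p = c' * face_weight t p ^ m" for p
    have v: "implementable K v" unfolding v_def
      using c' by (intro implementable_mult[OF K] implementable_const[OF K] implementable_power[OF K] implementable_face_weight[OF K]) auto
    have vle: "v p \<le> f p" "0 \<le> v p" if "p \<in> K" for p
    proof -
      have "v p \<le> c * face_weight t p ^ m" unfolding v_def using c' wb[OF that] by (intro mult_right_mono) auto
      also have "\<dots> \<le> f p" using c(2) insert.prems that by auto
      finally show "v p \<le> f p" .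
      show "0 \<le> v p" unfolding v_def using c' wb[OF that] by auto
    qed
    show ?case
    proof (intro exI conjI ballI impI)
      show "implementable K (\<lambda>p. 1/2 * u p + (1 - 1/2) * v p)"
        by (intro implementable_convex[OF K] u v) auto
      fix p assume p: "p \<in> K"
      show "1/2 * u p + (1 - 1/2) * v p \<le> f p" using u(2) vle p by force
      assume "\<exists>t\<in>insert t P. 0 < face_weight t p"
      then have "0 < v p \<or> 0 < u p" using u(3) p c' by (auto simp: v_def)
      then show "0 < 1/2 * u p + (1 - 1/2) * v p"
        using vle(2)[OF p] implementable_bounds(1)[OF u(1) K p] by auto
    qed
  qed
  have "finite (Collect good)" by simp
  from ex[OF this order_refl] obtain u where u: "implementable K u" "\<forall>p\<in>K. u p \<le> f p"
    "\<forall>p\<in>K. (\<exists>t\<in>Collect good. 0 < face_weight t p) \<longrightarrow> 0 < u p" by blast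
  show thesis
  proof (rule that[OF u(1)])
    fix p assume p: "p \<in> K"
    show "u p \<le> f p" using u p by blast
    assume fp: "0 < f p"
    define A S B where "A = {i. p $ i = 0}" and "S = {i. 0 < p $ i \<and> p $ i < 1}" and "B = {i. p $ i = 1}"
    have "0 \<le> p $ i \<and> p $ i \<le> 1" for i using p K by (auto simp: cube_def)
    then have part: "is_partition3 A S B" and face: "p \<in> open_face A S B"
      by (auto simp: is_partition3_def open_face_def A_def S_def B_def order_le_less)
    have "0 < face_weight (A, S, B) p"
      unfolding face_weight_def by (auto intro!: mult_pos_pos prod_pos simp: A_def S_def B_def)
    moreover have "good (A, S, B)" using part face p fp by (auto simp: good_def)
    ultimately show "0 < u p" using u(3) p by blast
  qed
qed

text \<open>At every point \<open>f\<close> or \<open>1 - f\<close> is positive, so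
  \<open>u + v\<close> is positive and, by compactness, at least some \<open>d > 0\<close>. Racing
  the minorants then gives an \<open>r\<close> that controls \<open>f\<close> with
  \<open>C = 1 / d\<close>.\<close>

lemma poly_bounded_imp_implementable:
  fixes K :: "(real^'n) set"
  assumes K: "K \<subseteq> cube" and "compact K" and cont: "continuous_on K f"
    and f: "\<And>p. p \<in> K \<Longrightarrow> 0 \<le> f p \<and> f p \<le> 1"
    and pb: "poly_bounded K f" "poly_bounded K (\<lambda>p. 1 - f p)"
  shows "implementable K f"
proof -
  obtain u where u: "implementable K u" "\<And>p. p \<in> K \<Longrightarrow> u p \<le> f p" "\<And>p. p \<in> K \<Longrightarrow> 0 < f p \<Longrightarrow> 0 < u p"
    using poly_bounded_minorant[OF K pb(1) f] by blast
  obtain v where v: "implementable K v" "\<And>p. p \<in> K \<Longrightarrow> v p \<le> 1 - f p" "\<And>p. p \<in> K \<Longrightarrow> 0 < 1 - f p \<Longrightarrow> 0 < v p"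
    by (rule poly_bounded_minorant[OF K pb(2)]) (use f in auto)
  note ub = implementable_bounds[OF u(1) K] and vb = implementable_bounds[OF v(1) K]
  have pos: "0 < u p + v p" if "p \<in> K" for p
    using f[OF that] u(3)[OF that] v(3)[OF that] ub[OF that] vb[OF that] by (cases "0 < f p") auto
  have cont_uv: "continuous_on K (\<lambda>p. u p + v p)"
    by (intro continuous_on_add implementable_imp_continuous_on[OF K] u v)
  obtain d where d: "0 < d" "\<And>p. p \<in> K \<Longrightarrow> d \<le> u p + v p"
    using compact_positive_lower_bound[OF \<open>compact K\<close> cont_uv pos] by blast
  define r where "r p = u p / (u p + v p)" for p
  have r1: "1 - r p = v p / (u p + v p)" if "p \<in> K" for p
    using pos[OF that] by (simp add: r_def field_simps)
  have "implementable K r" unfolding r_def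
    by (rule implementable_race[OF K u(1) v(1) pos])
  moreover have "controlled K r f" unfolding controlled_def
  proof (intro conjI exI[of _ "1 / d"] ballI impI)
    fix p assume p: "p \<in> K"
    have "x / (u p + v p) \<le> 1 / d * y" if "0 \<le> x" "x \<le> y" for x y
    proof -
      have "x / (u p + v p) \<le> y / d" using d p that by (intro frac_le) auto
      then show ?thesis by simp
    qed
    then show "r p \<le> 1 / d * f p" "1 - r p \<le> 1 / d * (1 - f p)"
      using r1[OF p] u(2)[OF p] v(2)[OF p] ub[OF p] vb[OF p] by (auto simp: r_def)
    show "f p = 0" if "r p = 0"
      using that pos[OF p] u(3)[OF p] f[OF p] by (force simp: r_def)
    show "f p = 1" if "r p = 1"
      using that pos[OF p] v(3)[OF p] f[OF p] r1[OF p] by force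
  qed (use f cont d in auto)
  ultimately show ?thesis by (rule controlled_imp_implementable[OF K \<open>compact K\<close>])
qed

theorem theorem2:
  fixes K :: "(real^'n) set" and f :: "real^'n \<Rightarrow> real"
  assumes "compact K"
    and "\<forall>p\<in>K. \<forall>i. 0 \<le> p$i \<and> p$i \<le> 1"
    and "\<forall>p\<in>K. 0 \<le> f p \<and> f p \<le> 1"
  shows "implementable K f \<longleftrightarrow>
           continuous_on K f \<and> poly_bounded K f \<and> poly_bounded K (\<lambda>p. 1 - f p)"
proof -
  have K: "K \<subseteq> cube" using assms(2) by (auto simp: cube_def)
  show ?thesis
    using implementable_imp_continuous_on[OF K] implementable_imp_poly_bounded[OF K]
      implementable_compl[OF K] poly_bounded_imp_implementable[OF K assms(1)] assms(3)
    by blast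
qed

end
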